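(* For $n\ge1$ let $\beta_{\mathrm{rainbow}}\in\mathcal S_n$ be the permutation $(1,n)(2,n-1)\cdots(\tfrac n2,\tfrac n2+1)$ if $n$ is even and $(1,n)(2,n-1)\cdots(\tfrac{n-1}2,\tfrac{n+3}2)(\tfrac{n+1}2)$ if $n$ is odd. Then, as formal power series, $$M(X,Y,A):=\sum_{n=1}^\infty X^n\sum_{\alpha\in\mathrm{Int}(n)}Y^{\|\alpha^{-1}\beta_{\mathrm{rainbow}}\|}A^{\|\alpha\|}=\frac{X+X^2(Y+A)}{1-X^2Y(1+2YA+A^2)}.$$
   Context: $\mathcal S_n$ is the symmetric group on $[n]$; $\#\alpha$ denotes the number of cycles of $\alpha\in\mathcal S_n$ and $\|\alpha\|=n-\#\alpha$. $\mathrm{Int}(n)$ is the set of interval partitions of $[n]$ (every block consists of consecutive integers), each identified with the permutation whose cycles are its blocks with elements listed in increasing order. *)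

theory Defs
  imports
    "HOL-Combinatorics.Combinatorics"
    "HOL-Combinatorics.Orbits"
    "HOL-Library.Disjoint_Sets"
    "HOL-Computational_Algebra.Formal_Power_Series"
begin

section \<open>Permutations\<close>

text \<open>
  Elements of the symmetric group are functions \<^term>\<open>p :: nat \<Rightarrow> nat\<close> with
  \<^term>\<open>p permutes {1..n}\<close>; the ambient \<^term>\<open>n\<close> is passed explicitly because fixed points
  in \<^term>\<open>{1..n}\<close> count as cycles.
\<close>

definition num_cycles :: "nat \<Rightarrow> (nat \<Rightarrow> nat) \<Rightarrow> nat" where
  "num_cycles n p = card (orbit p ` {1..n})"

definition perm_norm :: "nat \<Rightarrow> (nat \<Rightarrow> nat) \<Rightarrow> nat" where
  "perm_norm n p = n - num_cycles n p"

text \<open>The subtraction above never truncates.\<close>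

lemma num_cycles_le: "num_cycles n p \<le> n"
  unfolding num_cycles_def using card_image_le[of "{1..n}" "orbit p"] by simp

text \<open>
  The product of the transpositions \<open>(i, n + 1 - i)\<close> for \<open>1 \<le> i \<le> n div 2\<close>; for odd \<open>n\<close> the
  midpoint is fixed.
\<close>

definition rainbow :: "nat \<Rightarrow> nat \<Rightarrow> nat" where
  "rainbow n = foldr (\<circ>) (map (\<lambda>i. transpose i (n + 1 - i)) [1..<n div 2 + 1]) id"

lemma rainbow_apply: "rainbow n x = (if x \<in> {1..n} then n + 1 - x else x)"
proof -
  have "foldr (\<circ>) (map (\<lambda>i. transpose i (n + 1 - i)) [1..<k + 1]) q x =
      (if q x \<in> {1..k} \<or> n + 1 - q x \<in> {1..k} \<and> q x \<le> n then n + 1 - q x else q x)"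
    if "k \<le> n div 2" for k q
    using that
  proof (induction k arbitrary: q)
    case 0
    then show ?case by auto
  next
    case (Suc k)
    have "[1..<Suc k + 1] = [1..<k + 1] @ [Suc k]" by simp
    then have "foldr (\<circ>) (map (\<lambda>i. transpose i (n + 1 - i)) [1..<Suc k + 1]) q x =
        foldr (\<circ>) (map (\<lambda>i. transpose i (n + 1 - i)) [1..<k + 1])
          (transpose (Suc k) (n + 1 - Suc k) \<circ> q) x"
      by (simp only: map_append foldr_append list.map foldr.simps o_apply id_apply)
    also have "\<dots> = (let y = transpose (Suc k) (n + 1 - Suc k) (q x) in
        if y \<in> {1..k} \<or> n + 1 - y \<in> {1..k} \<and> y \<le> n then n + 1 - y else y)"
      unfolding Let_def o_apply[symmetric, of "transpose (Suc k) (n + 1 - Suc k)" q x]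
      by (rule Suc.IH) (use Suc.prems in simp)
    also have "\<dots> = (if q x \<in> {1..Suc k} \<or> n + 1 - q x \<in> {1..Suc k} \<and> q x \<le> n
        then n + 1 - q x else q x)"
      using Suc.prems by (auto simp: transpose_def Let_def)
    finally show ?case .
  qed
  from this[of "n div 2" id] show ?thesis
    unfolding rainbow_def by auto
qed

section \<open>Interval partitions\<close>

definition interval_partitions :: "nat \<Rightarrow> nat set set set" where
  "interval_partitions n = {P. partition_on {1..n} P \<and> (\<forall>B\<in>P. \<exists>i j. B = {i..j})}"

lemma finite_interval_partitions: "finite (interval_partitions n)"
  by (rule finite_subset[of _ "Pow (Pow {1..n})"])
    (auto simp: interval_partitions_def partition_on_def)

definition perm_of_partition :: "nat set set \<Rightarrow> nat \<Rightarrow> nat" where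
  "perm_of_partition P x =
    (if x \<in> \<Union>P then cycle_of_list (sorted_list_of_set (THE B. B \<in> P \<and> x \<in> B)) x else x)"

section \<open>Formal power series in three variables\<close>

text \<open>
  Power series in \<open>X, Y, A\<close> over the rationals are the iterated power series
  \<open>\<rat>[[A]][[Y]][[X]]\<close>, the outermost layer being \<open>X\<close>.
\<close>

abbreviation var_X :: "rat fps fps fps" where "var_X \<equiv> fps_X"
abbreviation var_Y :: "rat fps fps fps" where "var_Y \<equiv> fps_const fps_X"
abbreviation var_A :: "rat fps fps fps" where "var_A \<equiv> fps_const (fps_const fps_X)"

text \<open>
  Accordingly \<open>fps_X\<close> and \<open>fps_const fps_X\<close> below are \<open>Y\<close> and \<open>A\<close> in the coefficient
  ring \<open>\<rat>[[A]][[Y]]\<close>.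
\<close>

definition rainbow_coeff :: "nat \<Rightarrow> rat fps fps" where
  "rainbow_coeff n = (\<Sum>P\<in>interval_partitions n.
     fps_X ^ perm_norm n (inv (perm_of_partition P) \<circ> rainbow n) *
     (fps_const fps_X) ^ perm_norm n (perm_of_partition P))"

definition rainbow_series :: "rat fps fps fps" where
  "rainbow_series = Abs_fps (\<lambda>n. if n \<ge> 1 then rainbow_coeff n else 0)"

text \<open>
  The library division on \<^typ>\<open>rat fps fps fps\<close> is genuine whenever the denominator has constant
  coefficient 1 in \<open>X\<close>, although the coefficient ring is not a field.
\<close>

lemma divide_eq_iff_const_1:
  fixes f g h :: "rat fps fps fps"
  assumes "fps_nth g 0 = 1"
  shows "f / g = h \<longleftrightarrow> f = h * g"
proof -
  have one: "inverse (1 :: rat fps fps) = 1"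
    using fps_inverse_one'[where 'a = "rat fps"] by simp
  have inv: "inverse g * g = 1"
    unfolding fps_inverse_def[of g] assms one by (rule fps_left_inverse'[of 1]) (simp_all add: assms)
  have "subdegree g = 0" using assms by (simp add: subdegree_eq_0_iff)
  then have "f / g = f * inverse g" by (simp add: fps_divide_def)
  moreover have "f * inverse g = h" if "f = h * g"
    unfolding that mult.assoc mult.commute[of g] inv by simp
  moreover have "f = f * inverse g * g"
    unfolding mult.assoc inv by simp
  ultimately show ?thesis by auto
qed

end

theory Submission
  imports Defs
begin

text \<open>
  The permutation of an interval partition is the product, in increasing order, of the transpositions
  \<open>(i i+1)\<close> over those \<open>i\<close> that share a block with \<open>i + 1\<close>. Removing the points \<open>1\<close> and \<open>n\<close> leaves an
  interval partition of \<open>{2..n-1}\<close> and the reflection of that interval, and there are four ways back: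
  each of \<open>1\<close>, \<open>n\<close> is or is not joined to its neighbour. With no join the exponent of \<open>Y\<close> grows by
  one, with one join by two, and with both joins again by one, which gives the factor
  \<open>Y (1 + 2 Y A + A\<^sup>2)\<close> for passing from \<open>n - 2\<close> to \<open>n\<close>.
\<close>

section \<open>Cycle counts\<close>

text \<open>The map \<open>q\<close> intertwines the two products: \<open>q\<close> after
  \<open>p \<circ> q\<close> equals \<open>q \<circ> p\<close> after \<open>q\<close>, so it carries
  orbits to orbits.\<close>

lemma orbit_comp_swap:
  assumes "inj q"
  shows "orbit (q \<circ> p) (q x) = q ` orbit (p \<circ> q) x"
proof (intro equalityI subsetI)
  fix y assume "y \<in> orbit (q \<circ> p) (q x)"
  then show "y \<in> q ` orbit (p \<circ> q) x"
    by induction (force intro: orbit.intros)+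
next
  fix y assume "y \<in> q ` orbit (p \<circ> q) x"
  then obtain z where "z \<in> orbit (p \<circ> q) x" "y = q z" by blast
  then show "y \<in> orbit (q \<circ> p) (q x)"
  proof (induction arbitrary: y)
    case base
    then show ?case using orbit.base[of "q \<circ> p" "q x"] by (simp add: comp_def)
  next
    case (step z)
    then show ?case using orbit.step[of "q z" "q \<circ> p" "q x"] by (simp add: comp_def)
  qed
qed

text \<open>Swapping the factors amounts to conjugating by \<open>q\<close>, and conjugation
  preserves the number of cycles. This lets a transposition on the left of a product be moved to the
  right.\<close>

lemma perm_norm_comp_commute:
  assumes q: "q permutes {1..n}"
  shows "perm_norm n (q \<circ> p) = perm_norm n (p \<circ> q)"
proof -
  have inj: "inj q" using q by (rule permutes_inj)
  have "orbit (q \<circ> p) ` {1..n} = orbit (q \<circ> p) ` q ` {1..n}"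
    by (simp only: permutes_image[OF q])
  also have "\<dots> = (`) q ` orbit (p \<circ> q) ` {1..n}"
    by (simp add: image_image orbit_comp_swap[OF inj])
  finally show ?thesis
    using inj by (simp add: perm_norm_def num_cycles_def card_image inj_on_def inj_image_eq_iff)
qed

text \<open>The transposition splices the fixed point \<open>a\<close> into the cycle of
  \<open>b\<close>; all other cycles survive, so exactly one cycle is lost.\<close>

lemma perm_norm_comp_transpose:
  assumes p: "p permutes {1..n}" and a: "a \<in> {1..n}" "p a = a" and b: "b \<in> {1..n}" "a \<noteq> b"
  shows "perm_norm n (p \<circ> transpose a b) = Suc (perm_norm n p)"
proof -
  define q where "q = p \<circ> transpose a b"
  \<comment> \<open>The cycle of \<open>q\<close> that results from the merging.\<close>
  define C where "C = insert a (orbit p b)"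
  have perm: "permutation p" using p permutation_permutes by blast
  have refl: "x \<in> orbit p x" for x
    by (rule permutation_self_in_orbit[OF perm])
  have orb_eq: "orbit p x = orbit p y" if "x \<in> orbit p y" for x y
    using that by (meson orbit_cyclic_eq3 cyclic_on_orbit'[OF perm])
  have qa: "q a = p b" and qb: "q b = a" and qx: "x \<noteq> a \<Longrightarrow> x \<noteq> b \<Longrightarrow> q x = p x" for x
    using a by (auto simp: q_def)
  have orb_a: "orbit p a = {a}" using a by (simp add: orbit_eq_singleton_iff)
  have a_notin: "a \<notin> orbit p x" if "x \<noteq> a" for x
    using orb_eq[of a x] orb_a refl[of x] that by auto
  have "permutation q" unfolding q_def
    by (intro permutation_compose perm permutation_swap_id)
  have "C \<subseteq> orbit q b"
  proof
    fix y assume "y \<in> C"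
    moreover have a_in: "a \<in> orbit q b" using orbit.base[of q b] qb by simp
    moreover have "y \<in> orbit q b" if "y \<in> orbit p b" using that
    proof induction
      case base
      show ?case using orbit.step[OF a_in] qa by simp
    next
      case (step y)
      then show ?case
        using orbit.step[OF step.IH] orbit.step[OF a_in] a qa qx[of y] by (cases "y = a"; cases "y = b") auto
    qed
    ultimately show "y \<in> orbit q b" by (auto simp: C_def)
  qed
  moreover have "y \<in> C" if "y \<in> orbit q b" for y
    using that
  proof induction
    case base
    then show ?case by (simp add: qb C_def)
  next
    case (step y)
    then show ?case using qx[of y]
      by (cases "y = a"; cases "y = b") (auto simp: C_def qa qb intro: orbit.intros)
  qed
  ultimately have C: "orbit q b = C" by blast
  have qC: "orbit q x = C" if "x \<in> C" for x
    using that C by (metis \<open>permutation q\<close> orbit_cyclic_eq3 cyclic_on_orbit')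
  have qout: "orbit q x = orbit p x" if "x \<notin> C" for x
  proof (rule orbit_cong)
    \<comment> \<open>An orbit that starts outside \<open>C\<close> meets neither \<open>a\<close>
      nor \<open>b\<close>, so \<open>p\<close> and \<open>q\<close> agree along it.\<close>
    fix y assume "y \<in> orbit p x"
    then have "y \<noteq> a" "y \<noteq> b"
      using that a_notin[of x] orb_eq[of y x] refl[of x] by (auto simp: C_def)
    then show "q y = p y" by (rule qx)
  qed (rule refl)
  let ?O = "orbit p ` ({1..n} - C)"
  have "orbit q ` {1..n} = orbit q ` ({1..n} \<inter> C) \<union> orbit q ` ({1..n} - C)" by blast
  also have "orbit q ` ({1..n} \<inter> C) = {C}"
    using a by (auto simp: qC C_def)
  also have "orbit q ` ({1..n} - C) = ?O" by (rule image_cong) (auto simp: qout)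
  finally have nq: "orbit q ` {1..n} = insert C ?O" by simp
  have "orbit p ` {1..n} = insert (orbit p a) (orbit p ` ({1..n} \<inter> orbit p b) \<union> ?O)"
    using a by (auto simp: C_def)
  also have "orbit p ` ({1..n} \<inter> orbit p b) = {orbit p b}"
  proof -
    have "orbit p x = orbit p b" if "x \<in> {1..n} \<inter> orbit p b" for x
      using that by (intro orb_eq) simp
    moreover have "b \<in> {1..n} \<inter> orbit p b" using b refl by simp
    ultimately show ?thesis by (metis (no_types, lifting) empty_iff image_constant_conv image_cong)
  qed
  finally have np: "orbit p ` {1..n} = insert {a} (insert (orbit p b) ?O)"
    by (simp add: orb_a)
  \<comment> \<open>Every orbit in \<open>?O\<close> contains its own starting point, which lies
    outside \<open>C\<close>.\<close>
  have *: "A \<notin> ?O" if "A \<subseteq> C" for A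
    using that refl by blast
  have "orbit p b \<notin> ?O" "C \<notin> ?O" "{a} \<notin> insert (orbit p b) ?O"
    using *[of "{a}"] *[of "orbit p b"] *[of C] a_notin[of b] b by (auto simp: C_def)
  then have "card (orbit p ` {1..n}) = Suc (card (orbit q ` {1..n}))"
    unfolding np nq by simp
  \<comment> \<open>The bound by \<open>n\<close> keeps the truncated subtraction in
    \<open>perm_norm\<close> exact.\<close>
  then show ?thesis
    using num_cycles_le[of n p] by (simp add: perm_norm_def num_cycles_def q_def)
qed

section \<open>The permutation of an interval partition\<close>

text \<open>\<open>cycle_of_list\<close> splits off the transposition of the first two list entries,
  so the induction lowers the left end \<open>i\<close>, starting from \<open>j\<close>.\<close>

lemma cycle_of_list_upt:
  "i \<le> j \<Longrightarrow> cycle_of_list [i..<Suc j] x = (if x = j then i else if x \<in> {i..<j} then Suc x else x)"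
proof (induction i rule: inc_induct)
  case base
  then show ?case by simp
next
  case (step i)
  then have "[i..<Suc j] = i # Suc i # [Suc (Suc i)..<Suc j]"
    and "[Suc i..<Suc j] = Suc i # [Suc (Suc i)..<Suc j]"
    by (simp_all add: upt_conv_Cons)
  then show ?case using step by (auto simp: transpose_def)
qed

lemma perm_of_partition_interval:
  assumes P: "partition_on A P" and B: "{i..j} \<in> P" and x: "x \<in> {i..j}"
  shows "perm_of_partition P x = (if x = j then i else Suc x)"
proof -
  have "(THE B. B \<in> P \<and> x \<in> B) = {i..j}"
  proof (rule the_equality)
    show "{i..j} \<in> P \<and> x \<in> {i..j}" using B x by blast
    show "B = {i..j}" if "B \<in> P \<and> x \<in> B" for B
    proof (rule ccontr)
      assume "B \<noteq> {i..j}"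
      then have "B \<inter> {i..j} = {}" using disjointD[OF partition_onD2[OF P]] B that by blast
      then show False using x that by blast
    qed
  qed
  moreover have "sorted_list_of_set {i..j} = [i..<Suc j]"
    by (metis sorted_list_of_set_range atLeastLessThanSuc_atLeastAtMost)
  ultimately show ?thesis
    using B x cycle_of_list_upt[of i j x] by (auto simp: perm_of_partition_def)
qed

lemma perm_of_partition_outside: "x \<notin> \<Union>P \<Longrightarrow> perm_of_partition P x = x"
  by (simp add: perm_of_partition_def)

section \<open>Interval partitions built up from the right end\<close>

lemma interval_partitions_0: "interval_partitions 0 = {{}}"
  by (auto simp: interval_partitions_def partition_on_empty)

lemma interval_partitions_insert_last:
  assumes R: "R \<in> interval_partitions (i - 1)" and i: "1 \<le> i" "i \<le> n"
  shows "insert {i..n} R \<in> interval_partitions n"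
proof -
  have U: "\<Union>R = {1..i - 1}" using R by (auto simp: interval_partitions_def partition_on_def)
  have "disjnt {i..n} (\<Union>R)" unfolding U using i by (auto simp: disjnt_iff)
  moreover have "{1..n} - {i..n} = {1..i - 1}" using i by auto
  ultimately have "partition_on {1..n} (insert {i..n} R)"
    using R i by (auto simp: partition_on_insert interval_partitions_def)
  then show ?thesis using R by (auto simp: interval_partitions_def)
qed

text \<open>The block of \<open>n\<close> must be a final segment; \<open>i\<close> is its left end.
  For \<open>i = 1\<close> the rest \<open>R\<close> is the empty partition of the empty
  set.\<close>

lemma interval_partitions_cases:
  assumes P: "P \<in> interval_partitions n" and "1 \<le> n"
  obtains i R where "1 \<le> i" "i \<le> n" "R \<in> interval_partitions (i - 1)" "P = insert {i..n} R"
proof -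
  have part: "partition_on {1..n} P" and int: "\<And>B. B \<in> P \<Longrightarrow> \<exists>i j. B = {i..j}"
    using P by (auto simp: interval_partitions_def)
  have "n \<in> \<Union>P" using part \<open>1 \<le> n\<close> by (auto simp: partition_on_def)
  then obtain B where B: "B \<in> P" "n \<in> B" by blast
  then obtain i j where ij: "B = {i..j}" using int by blast
  have sub: "B \<subseteq> {1..n}" using part B by (auto simp: partition_on_def)
  have "j = n" and i: "1 \<le> i" "i \<le> n" using sub B(2) unfolding ij by auto
  define R where "R = P - {B}"
  have PR: "P = insert {i..n} R" using B ij \<open>j = n\<close> by (auto simp: R_def)
  have "B \<inter> C = {}" if "C \<in> R" for C
    using disjointD[OF partition_onD2[OF part]] B(1) that by (auto simp: R_def)
  then have "disjnt {i..n} (\<Union>R)"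
    using ij \<open>j = n\<close> by (auto simp: disjnt_def)
  then have "partition_on ({1..n} - {i..n}) R" using part PR by (simp add: partition_on_insert)
  moreover have "{1..n} - {i..n} = {1..i - 1}" using i by auto
  ultimately have "R \<in> interval_partitions (i - 1)"
    using int by (auto simp: interval_partitions_def R_def)
  then show thesis using that i PR by blast
qed

text \<open>Acting on all blocks at once avoids choosing the last one, and deleting
  \<open>Suc n\<close> from every block is then a left inverse.\<close>

definition extend_last :: "nat \<Rightarrow> nat set set \<Rightarrow> nat set set" where
  "extend_last n P = (\<lambda>B. if n \<in> B then insert (Suc n) B else B) ` P"

lemma extend_last_insert:
  assumes "R \<in> interval_partitions (i - 1)" "1 \<le> i" "i \<le> n"
  shows "extend_last n (insert {i..n} R) = insert {i..Suc n} R"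
proof -
  have "B \<subseteq> {1..i - 1}" if "B \<in> R" for B
    using assms that by (auto simp: interval_partitions_def partition_on_def)
  then have "n \<notin> B" if "B \<in> R" for B using that assms by fastforce
  then show ?thesis using assms by (auto simp: extend_last_def atLeastAtMostSuc_conv)
qed

text \<open>The last point is either a block by itself or joined to the block of its predecessor,
  according to whether the left end of its block is \<open>Suc n\<close>.\<close>

lemma interval_partitions_Suc:
  assumes n: "1 \<le> n"
  shows "interval_partitions (Suc n) =
    insert {Suc n} ` interval_partitions n \<union> extend_last n ` interval_partitions n"
proof (intro equalityI subsetI)
  fix Q assume "Q \<in> interval_partitions (Suc n)"
  then obtain i R where R: "1 \<le> i" "i \<le> Suc n" "R \<in> interval_partitions (i - 1)"
    "Q = insert {i..Suc n} R"
    using n by (metis interval_partitions_cases le_SucI)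
  show "Q \<in> insert {Suc n} ` interval_partitions n \<union> extend_last n ` interval_partitions n"
  proof (cases "i = Suc n")
    case True
    then show ?thesis using R by auto
  next
    case False
    then have "Q = extend_last n (insert {i..n} R)" using R by (simp add: extend_last_insert)
    then show ?thesis using R False interval_partitions_insert_last[of R i n] by auto
  qed
next
  fix Q assume "Q \<in> insert {Suc n} ` interval_partitions n \<union> extend_last n ` interval_partitions n"
  then consider P where "P \<in> interval_partitions n" "Q = insert {Suc n} P"
    | P where "P \<in> interval_partitions n" "Q = extend_last n P" by blast
  then show "Q \<in> interval_partitions (Suc n)"
  proof cases
    case 1
    then show ?thesis using interval_partitions_insert_last[of P "Suc n" "Suc n"] by simp
  next
    case 2
    then obtain i R where "1 \<le> i" "i \<le> n" "R \<in> interval_partitions (i - 1)" "P = insert {i..n} R"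
      using n interval_partitions_cases by blast
    then show ?thesis using 2 interval_partitions_insert_last[of R i "Suc n"]
      by (simp add: extend_last_insert)
  qed
qed

lemma Suc_notin_interval_partition:
  assumes "P \<in> interval_partitions n" "B \<in> P"
  shows "Suc n \<notin> B"
proof -
  have "B \<subseteq> {1..n}" using assms by (auto simp: interval_partitions_def partition_on_def)
  then show ?thesis by auto
qed

lemma inj_on_insert_last: "inj_on (insert {Suc n}) (interval_partitions n)"
proof (rule inj_on_inverseI)
  fix P assume "P \<in> interval_partitions n"
  then have "{Suc n} \<notin> P" using Suc_notin_interval_partition by blast
  then show "insert {Suc n} P - {{Suc n}} = P" by simp
qed

lemma inj_on_extend_last: "inj_on (extend_last n) (interval_partitions n)"
proof (rule inj_on_inverseI)
  fix P assume "P \<in> interval_partitions n"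
  then have "(if n \<in> B then insert (Suc n) B else B) - {Suc n} = B" if "B \<in> P" for B
    using that Suc_notin_interval_partition by auto
  then show "(\<lambda>B. B - {Suc n}) ` extend_last n P = P"
    unfolding extend_last_def image_image by simp
qed

lemma insert_last_extend_last_disjoint:
  "insert {Suc n} ` interval_partitions n \<inter> extend_last n ` interval_partitions n = {}"
proof -
  have "{Suc n} \<notin> extend_last n P" if "P \<in> interval_partitions n" for P
  proof
    assume "{Suc n} \<in> extend_last n P"
    then obtain B where "B \<in> P" "{Suc n} = (if n \<in> B then insert (Suc n) B else B)"
      by (auto simp: extend_last_def)
    then show False
      using Suc_notin_interval_partition[OF that, of B] by (auto split: if_splits)
  qed
  then show ?thesis by blast
qed

text \<open>A singleton block and a point outside all blocks are both fixed points.\<close>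

lemma perm_of_partition_insert_last:
  assumes P: "P \<in> interval_partitions n"
  shows "perm_of_partition (insert {Suc n} P) = perm_of_partition P"
proof
  fix x
  have part: "partition_on {1..n} P" and int: "\<And>B. B \<in> P \<Longrightarrow> \<exists>i j. B = {i..j}"
    using P by (auto simp: interval_partitions_def)
  have Q: "insert {Suc n..Suc n} P \<in> interval_partitions (Suc n)"
    by (rule interval_partitions_insert_last) (use P in auto)
  then have part': "partition_on {1..Suc n} (insert {Suc n} P)" by (simp add: interval_partitions_def)
  consider B where "B \<in> P" "x \<in> B" | "x = Suc n" | "x \<notin> \<Union>(insert {Suc n} P)" by blast
  then show "perm_of_partition (insert {Suc n} P) x = perm_of_partition P x"
  proof cases
    case 1
    then obtain i j where "{i..j} \<in> P" "x \<in> {i..j}" using int by blast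
    then show ?thesis
      using perm_of_partition_interval[OF part] perm_of_partition_interval[OF part'] by auto
  next
    case 2
    then show ?thesis
      using perm_of_partition_interval[OF part', of "Suc n" "Suc n" x]
        Suc_notin_interval_partition[OF P] by (auto simp: perm_of_partition_outside)
  next
    case 3
    then show ?thesis by (simp add: perm_of_partition_outside)
  qed
qed

text \<open>In the product, \<open>n\<close> goes to \<open>Suc n\<close>, which the old permutation
  fixes, and \<open>Suc n\<close> goes to the old image \<open>i\<close> of \<open>n\<close>. So the
  new point enters the last cycle right after \<open>n\<close>.\<close>

lemma perm_of_partition_extend_last:
  assumes P: "P \<in> interval_partitions n" and n: "1 \<le> n"
  shows "perm_of_partition (extend_last n P) = perm_of_partition P \<circ> transpose n (Suc n)"
proof
  fix x
  have part: "partition_on {1..n} P" and int: "\<And>B. B \<in> P \<Longrightarrow> \<exists>i j. B = {i..j}"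
    using P by (auto simp: interval_partitions_def)
  obtain i R where i: "1 \<le> i" "i \<le> n" and R: "R \<in> interval_partitions (i - 1)"
    and PR: "P = insert {i..n} R"
    using P n interval_partitions_cases by blast
  have Q: "extend_last n P = insert {i..Suc n} R" using i R PR by (simp add: extend_last_insert)
  have part': "partition_on {1..Suc n} (insert {i..Suc n} R)"
    using interval_partitions_insert_last[OF R, of "Suc n"] i by (simp add: interval_partitions_def)
  have U: "\<Union>R = {1..i - 1}" using R by (auto simp: interval_partitions_def partition_on_def)
  have last: "perm_of_partition P y = (if y = n then i else Suc y)" if "y \<in> {i..n}" for y
    using perm_of_partition_interval[OF part _ that] PR by simp
  have last': "perm_of_partition (extend_last n P) y = (if y = Suc n then i else Suc y)"
    if "y \<in> {i..Suc n}" for y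
    unfolding Q using perm_of_partition_interval[OF part' _ that] by simp
  have fix_Suc: "perm_of_partition P (Suc n) = Suc n"
    using Suc_notin_interval_partition[OF P] by (auto simp: perm_of_partition_outside)
  consider "x \<in> {i..Suc n}" | "x \<in> \<Union>R" | "x \<notin> \<Union>(insert {i..Suc n} R)" by blast
  then show "perm_of_partition (extend_last n P) x = (perm_of_partition P \<circ> transpose n (Suc n)) x"
  proof cases
    case 1
    then show ?thesis using last last' fix_Suc i by (auto simp: transpose_def)
  next
    case 2
    then have ne: "x \<noteq> n" "x \<noteq> Suc n" using U i by auto
    obtain B where B: "B \<in> R" "x \<in> B" using 2 by blast
    moreover obtain k l where "B = {k..l}" using int B(1) PR by blast
    ultimately have kl: "{k..l} \<in> R" "x \<in> {k..l}" by simp_all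
    then have "perm_of_partition (extend_last n P) x = perm_of_partition P x"
      unfolding Q using perm_of_partition_interval[OF part _ kl(2)]
        perm_of_partition_interval[OF part' _ kl(2)] PR by simp
    then show ?thesis using ne by simp
  next
    case 3
    then have "x \<noteq> n" "x \<noteq> Suc n" using i by auto
    moreover have "x \<notin> \<Union>P" using 3 PR by auto
    ultimately show ?thesis using 3 Q by (simp add: perm_of_partition_outside)
  qed
qed

section \<open>Products of adjacent transpositions\<close>

text \<open>The smallest index stands leftmost, hence acts last; this order makes a run of
  consecutive indices an increasing cycle.\<close>

definition transpose_prod :: "nat set \<Rightarrow> nat \<Rightarrow> nat" where
  "transpose_prod S = foldr (\<lambda>i p. transpose i (Suc i) \<circ> p) (sorted_list_of_set S) id"

lemma transpose_prod_empty [simp]: "transpose_prod {} = id"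
  by (simp add: transpose_prod_def)

text \<open>A new minimum is a factor on the left and, in the next lemma, a new maximum is one on
  the right; peeling an interval at both ends needs both.\<close>

lemma transpose_prod_insert_less:
  assumes "finite S" "\<And>s. s \<in> S \<Longrightarrow> m < s"
  shows "transpose_prod (insert m S) = transpose m (Suc m) \<circ> transpose_prod S"
proof -
  have "m \<notin> S" using assms by blast
  moreover have "insort m (sorted_list_of_set S) = m # sorted_list_of_set S"
    by (rule insort_is_Cons) (use assms in \<open>auto simp: less_imp_le\<close>)
  ultimately show ?thesis using assms by (simp add: transpose_prod_def)
qed

lemma transpose_prod_insert_greater:
  assumes "finite S" "\<And>s. s \<in> S \<Longrightarrow> s < m"
  shows "transpose_prod (insert m S) = transpose_prod S \<circ> transpose m (Suc m)"
proof -
  have "m \<notin> S" using assms by blast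
  moreover have "insort m (sorted_list_of_set S) = sorted_list_of_set S @ [m]"
    by (rule sorted_insort_is_snoc) (use assms in \<open>auto simp: less_imp_le\<close>)
  moreover have "foldr (\<lambda>i p. transpose i (Suc i) \<circ> p) xs q =
      foldr (\<lambda>i p. transpose i (Suc i) \<circ> p) xs id \<circ> q" for xs q
    by (induction xs) (simp_all add: comp_assoc)
  then have "foldr (\<lambda>i p. transpose i (Suc i) \<circ> p) (xs @ [m]) id =
      foldr (\<lambda>i p. transpose i (Suc i) \<circ> p) xs id \<circ> transpose m (Suc m)" for xs
    unfolding foldr_append by simp
  ultimately show ?thesis using assms by (simp add: transpose_prod_def)
qed

lemma sum_Pow_insert:
  assumes "finite A" "x \<notin> A"
  shows "sum f (Pow (insert x A)) = (\<Sum>S\<in>Pow A. f S + f (insert x S))"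
proof -
  have "inj_on (insert x) (Pow A)" using assms by (auto simp: inj_on_def)
  moreover have "Pow A \<inter> insert x ` Pow A = {}" using assms by auto
  ultimately show ?thesis
    using assms by (simp add: Pow_insert sum.union_disjoint sum.reindex sum.distrib)
qed

text \<open>Both sides double in the same way from \<open>n\<close> to \<open>Suc n\<close>: the
  last point is joined or not, and \<open>n\<close> lies in \<open>S\<close> or not. Summing an
  arbitrary \<open>f\<close> of the permutation avoids an explicit bijection.\<close>

lemma sum_interval_partitions:
  assumes "1 \<le> n"
  shows "(\<Sum>P\<in>interval_partitions n. f (perm_of_partition P)) =
    (\<Sum>S\<in>Pow {1..<n}. f (transpose_prod S))"
  using assms
proof (induction n arbitrary: f rule: nat_induct_at_least)
  case base
  have "interval_partitions 1 = {{{1}}}"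
  proof (intro equalityI subsetI)
    fix P assume "P \<in> interval_partitions 1"
    then show "P \<in> {{{1}}}"
      by (rule interval_partitions_cases) (auto simp: interval_partitions_0 le_antisym)
  next
    fix P assume "P \<in> {{{1::nat}}}"
    then show "P \<in> interval_partitions 1"
      using interval_partitions_insert_last[of "{}" 1 1] by (simp add: interval_partitions_0)
  qed
  moreover have "perm_of_partition {{1}} = id"
  proof
    fix x :: nat
    have "partition_on {1} {{1::nat}}" by (simp add: partition_on_space)
    then show "perm_of_partition {{1}} x = id x"
      using perm_of_partition_interval[of "{1}" "{{1}}" 1 1 x]
      by (cases "x = 1") (auto simp: perm_of_partition_outside)
  qed
  ultimately show ?case by simp
next
  case (Suc n)
  have "{1..<Suc n} = insert n {1..<n}" using Suc.hyps by auto
  then have "(\<Sum>S\<in>Pow {1..<Suc n}. f (transpose_prod S)) =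
      (\<Sum>S\<in>Pow {1..<n}. f (transpose_prod S) + f (transpose_prod (insert n S)))"
    by (simp add: sum_Pow_insert)
  also have "\<dots> = (\<Sum>S\<in>Pow {1..<n}. f (transpose_prod S) +
      f (transpose_prod S \<circ> transpose n (Suc n)))"
    by (intro sum.cong refl arg_cong2[where f = "(+)"] arg_cong[where f = f]
        transpose_prod_insert_greater) (auto dest: finite_subset)
  \<comment> \<open>The induction hypothesis is used for the function sending \<open>p\<close> to
    \<open>f p + f (p \<circ> transpose n (Suc n))\<close>.\<close>
  also have "\<dots> = (\<Sum>P\<in>interval_partitions n. f (perm_of_partition P) +
      f (perm_of_partition P \<circ> transpose n (Suc n)))"
    by (rule Suc.IH[symmetric])
  also have "\<dots> = (\<Sum>P\<in>interval_partitions n. f (perm_of_partition (insert {Suc n} P)) +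
      f (perm_of_partition (extend_last n P)))"
    using Suc.hyps
    by (intro sum.cong) (simp_all add: perm_of_partition_insert_last perm_of_partition_extend_last)
  also have "\<dots> = (\<Sum>P\<in>interval_partitions (Suc n). f (perm_of_partition P))"
    unfolding interval_partitions_Suc[OF Suc.hyps]
    by (subst sum.union_disjoint)
      (simp_all add: finite_interval_partitions insert_last_extend_last_disjoint sum.distrib
        sum.reindex inj_on_insert_last inj_on_extend_last)
  finally show ?case by simp
qed

lemma transpose_prod_permutes:
  assumes "S \<subseteq> {a..<b}"
  shows "transpose_prod S permutes {a..b}"
proof -
  have "finite S" using assms finite_subset by blast
  then show ?thesis using assms
  proof (induction rule: finite_linorder_max_induct)
    case empty
    show ?case unfolding transpose_prod_empty by (rule permutes_id)
  next
    case (insert m S)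
    then have "transpose m (Suc m) permutes {a..b}" by (intro permutes_swap_id) auto
    moreover have "transpose_prod S permutes {a..b}" using insert by simp
    moreover have "transpose_prod (insert m S) = transpose_prod S \<circ> transpose m (Suc m)"
      using insert.hyps by (intro transpose_prod_insert_greater) auto
    ultimately show ?case by (simp only: permutes_compose)
  qed
qed

text \<open>Factors are added in increasing order: the product over indices below \<open>m\<close>
  fixes \<open>Suc m\<close>, and the factor for \<open>m\<close> attaches that point to the cycle
  of \<open>m\<close>.\<close>

lemma perm_norm_transpose_prod:
  assumes "S \<subseteq> {1..<n}"
  shows "perm_norm n (transpose_prod S) = card S"
proof -
  have "finite S" using assms finite_subset by blast
  then show ?thesis using assms
  proof (induction rule: finite_linorder_max_induct)
    case empty
    have "orbit id x = {x}" for x :: nat by (simp add: orbit_eq_singleton_iff)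
    then have "card (orbit id ` {1..n}) = n" by (simp add: card_image)
    then show ?case unfolding transpose_prod_empty perm_norm_def num_cycles_def by simp
  next
    case (insert m S)
    have sub: "S \<subseteq> {1..<m}" using insert.hyps insert.prems by auto
    then have "transpose_prod S permutes {1..m}" by (rule transpose_prod_permutes)
    then have "transpose_prod S (Suc m) = Suc m" by (rule permutes_not_in) simp
    moreover have "transpose_prod S permutes {1..n}"
      by (rule transpose_prod_permutes) (use insert.prems in auto)
    ultimately have "perm_norm n (transpose_prod S \<circ> transpose (Suc m) m) =
        Suc (perm_norm n (transpose_prod S))"
      using insert.prems by (intro perm_norm_comp_transpose) auto
    then show ?case
      using insert sub by (subst transpose_prod_insert_greater) (auto simp: transpose_commute)
  qed
qed


section \<open>Peeling off the two outer points\<close>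

text \<open>The rainbow on an arbitrary interval, as it occurs once outer arcs are removed.\<close>

definition reflection :: "nat \<Rightarrow> nat \<Rightarrow> nat \<Rightarrow> nat" where
  "reflection a b x = (if x \<in> {a..b} then a + b - x else x)"

lemma reflection_permutes: "reflection a b permutes {a..b}"
proof (rule bij_imp_permutes)
  show "bij_betw (reflection a b) {a..b} {a..b}"
    by (rule bij_betw_byWitness[of _ "reflection a b"]) (auto simp: reflection_def)
qed (auto simp: reflection_def)

lemma rainbow_eq_reflection: "rainbow n = reflection 1 n"
  by (auto simp: rainbow_apply reflection_def)

text \<open>The outermost arc is split off; for \<open>b = Suc a\<close> the inner interval is
  empty.\<close>

lemma reflection_peel:
  assumes "a < b"
  shows "reflection a b = reflection (Suc a) (b - 1) \<circ> transpose a b"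
  using assms by (auto simp: reflection_def transpose_def fun_eq_iff)

lemma inv_transpose_comp:
  assumes "bij p"
  shows "inv (transpose i j \<circ> p) = inv p \<circ> transpose i j"
    and "inv (p \<circ> transpose i j) = transpose i j \<circ> inv p"
  using assms by (simp_all add: o_inv_distrib)

text \<open>The exponent of \<open>A\<close> is a separate number because it is the norm of another
  permutation than \<open>p\<close>.\<close>

definition monomial :: "nat \<Rightarrow> (nat \<Rightarrow> nat) \<Rightarrow> nat \<Rightarrow> rat fps fps" where
  "monomial n p k = fps_X ^ perm_norm n p * (fps_const fps_X) ^ k"

text \<open>The ambient \<open>{1..n}\<close> stays fixed while the interval \<open>{a..b}\<close> shrinks, so that no relabelling is
  needed in the recursion.\<close>

definition weight :: "nat \<Rightarrow> nat \<Rightarrow> nat \<Rightarrow> rat fps fps" where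
  "weight n a b =
    (\<Sum>S\<in>Pow {a..<b}. monomial n (inv (transpose_prod S) \<circ> reflection a b) (card S))"

lemma weight_self: "weight n a a = 1"
proof -
  have "reflection a a = id" by (auto simp: reflection_def)
  moreover have "perm_norm n id = 0" using perm_norm_transpose_prod[of "{}" n] by simp
  ultimately show ?thesis by (simp add: weight_def monomial_def)
qed

text \<open>The empty set leaves a single transposition, giving \<open>Y\<close>; the set
  \<open>{a}\<close> cancels it and contributes \<open>A\<close>.\<close>

lemma weight_Suc:
  assumes "1 \<le> a" "Suc a \<le> n"
  shows "weight n a (Suc a) = fps_X + fps_const fps_X"
proof -
  have refl: "reflection a (Suc a) = transpose a (Suc a)"
    by (auto simp: reflection_def transpose_def fun_eq_iff)
  have "{a..<Suc a} = insert a {}" by auto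
  then have Pow: "Pow {a..<Suc a} = {{}, {a}}" by auto
  have tp: "transpose_prod {a} = transpose a (Suc a)"
    by (subst transpose_prod_insert_less) auto
  have "perm_norm n (transpose a (Suc a)) = 1"
    using perm_norm_transpose_prod[of "{a}" n] assms tp by simp
  moreover have "perm_norm n id = 0" using perm_norm_transpose_prod[of "{}" n] by simp
  ultimately show ?thesis
    unfolding weight_def Pow by (simp add: tp refl monomial_def)
qed

text \<open>Up to conjugation, passing from the inner permutation \<open>s\<close> to the outer one multiplies \<open>s\<close> by
  transpositions each of which attaches a fixed point to another cycle; when both ends are joined,
  everything cancels except \<open>(a b)\<close>.\<close>

lemma perm_norm_peel:
  assumes s: "s permutes {1..n}" and fix_s: "s a = a" "s b = b"
    and ab: "a \<in> {1..n}" "b \<in> {1..n}" "c \<in> {1..n}" "a \<noteq> b" "c \<noteq> a" "c \<noteq> b"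
  shows "perm_norm n (s \<circ> transpose a b) = Suc (perm_norm n s)"
    and "perm_norm n (transpose c b \<circ> (s \<circ> transpose a b)) = Suc (Suc (perm_norm n s))"
    and "perm_norm n (s \<circ> transpose a c \<circ> transpose a b) = Suc (Suc (perm_norm n s))"
    and "perm_norm n (transpose c b \<circ> (s \<circ> transpose a c \<circ> transpose a b)) = Suc (perm_norm n s)"
proof -
  have tr: "transpose x y permutes {1..n}" if "x \<in> {1..n}" "y \<in> {1..n}" for x y
    using that by (rule permutes_swap_id)
  have s_tr: "s \<circ> transpose x y permutes {1..n}" if "x \<in> {1..n}" "y \<in> {1..n}" for x y
    by (rule permutes_compose[OF tr[OF that] s])
  show 1: "perm_norm n (s \<circ> transpose a b) = Suc (perm_norm n s)"
    by (rule perm_norm_comp_transpose) (use assms in auto)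
  have "perm_norm n (transpose c b \<circ> (s \<circ> transpose a b)) =
      perm_norm n (s \<circ> transpose a b \<circ> transpose c b)"
    by (rule perm_norm_comp_commute[OF tr]) (use ab in auto)
  \<comment> \<open>Two factorisations of one 3-cycle; the second attaches first \<open>b\<close>
    and then \<open>a\<close> to the cycle of \<open>c\<close>.\<close>
  also have "s \<circ> transpose a b \<circ> transpose c b = s \<circ> transpose b c \<circ> transpose a c"
    using ab by (auto simp: transpose_def fun_eq_iff)
  also have "perm_norm n \<dots> = Suc (perm_norm n (s \<circ> transpose b c))"
    by (rule perm_norm_comp_transpose[OF s_tr]) (use assms in auto)
  also have "perm_norm n (s \<circ> transpose b c) = Suc (perm_norm n s)"
    by (rule perm_norm_comp_transpose) (use assms in auto)
  finally show "perm_norm n (transpose c b \<circ> (s \<circ> transpose a b)) = Suc (Suc (perm_norm n s))" .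
  \<comment> \<open>The arguments are swapped because the point still fixed by
    \<open>s \<circ> transpose a c\<close> is \<open>b\<close>.\<close>
  have "perm_norm n (s \<circ> transpose a c \<circ> transpose a b) =
      perm_norm n (s \<circ> transpose a c \<circ> transpose b a)"
    by (simp add: transpose_commute)
  also have "\<dots> = Suc (perm_norm n (s \<circ> transpose a c))"
    by (rule perm_norm_comp_transpose[OF s_tr]) (use assms in auto)
  also have "perm_norm n (s \<circ> transpose a c) = Suc (perm_norm n s)"
    by (rule perm_norm_comp_transpose) (use assms in auto)
  finally show "perm_norm n (s \<circ> transpose a c \<circ> transpose a b) = Suc (Suc (perm_norm n s))" .
  have "perm_norm n (transpose c b \<circ> (s \<circ> transpose a c \<circ> transpose a b)) =
      perm_norm n (s \<circ> transpose a c \<circ> transpose a b \<circ> transpose c b)"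
    by (rule perm_norm_comp_commute[OF tr]) (use ab in auto)
  \<comment> \<open>Here \<open>(a b)(c b) = (a c)(a b)\<close>, so the leading \<open>(a c)\<close>
    cancels.\<close>
  also have "s \<circ> transpose a c \<circ> transpose a b \<circ> transpose c b = s \<circ> transpose a b"
    using ab by (auto simp: transpose_def fun_eq_iff)
  finally show "perm_norm n (transpose c b \<circ> (s \<circ> transpose a c \<circ> transpose a b)) =
      Suc (perm_norm n s)"
    unfolding 1 .
qed

definition growth :: "rat fps fps" where
  "growth = fps_X * (1 + 2 * fps_X * fps_const fps_X + (fps_const fps_X) ^ 2)"

text \<open>The sets \<open>S\<close> are sorted by whether they contain \<open>a\<close> and
  \<open>b - 1\<close>, the indices of the joins at the two ends. The four classes match the four
  parts of \<open>perm_norm_peel\<close>.\<close>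

lemma weight_peel:
  assumes "1 \<le> a" "a + 2 \<le> b" "b \<le> n"
  shows "weight n a b = growth * weight n (Suc a) (b - 1)"
proof -
  obtain c where b: "b = Suc c" and ac: "a < c" using assms by (cases b) auto
  define I where "I = {Suc a..<c}"
  have "{a..<b} = insert a (insert c I)" using b ac by (auto simp: I_def)
  moreover have "finite I" "a \<notin> insert c I" "c \<notin> I" using ac by (auto simp: I_def)
  ultimately have sum_eq: "sum f (Pow {a..<b}) =
      (\<Sum>S\<in>Pow I. f S + f (insert a S) + (f (insert c S) + f (insert a (insert c S))))"
    for f :: "nat set \<Rightarrow> rat fps fps"
    by (simp add: sum_Pow_insert)
  have ring_eq: "y ^ Suc d * x ^ k + y ^ Suc (Suc d) * x ^ Suc k +
      (y ^ Suc (Suc d) * x ^ Suc k + y ^ Suc d * x ^ Suc (Suc k)) =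
      y * (1 + 2 * y * x + x\<^sup>2) * (y ^ d * x ^ k)" for x y :: "rat fps fps" and d k
    by (simp add: algebra_simps power2_eq_square)
  have "monomial n (inv (transpose_prod S) \<circ> reflection a b) (card S) +
      monomial n (inv (transpose_prod (insert a S)) \<circ> reflection a b) (card (insert a S)) +
      (monomial n (inv (transpose_prod (insert c S)) \<circ> reflection a b) (card (insert c S)) +
       monomial n (inv (transpose_prod (insert a (insert c S))) \<circ> reflection a b)
        (card (insert a (insert c S)))) =
      growth * monomial n (inv (transpose_prod S) \<circ> reflection (Suc a) c) (card S)"
    if S: "S \<in> Pow I" for S
  proof -
    have fin: "finite S" using S \<open>finite I\<close> by (auto intro: finite_subset)
    have notin: "a \<notin> S" "c \<notin> S" using S by (auto simp: I_def)
    define p where "p = transpose_prod S"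
    define r where "r = reflection (Suc a) c"
    define s where "s = inv p \<circ> r"
    have p: "p permutes {Suc a..c}"
      unfolding p_def by (rule transpose_prod_permutes) (use S in \<open>simp add: I_def\<close>)
    have r: "r permutes {Suc a..c}" unfolding r_def by (rule reflection_permutes)
    have s: "s permutes {Suc a..c}" unfolding s_def by (intro permutes_compose r permutes_inv p)
    have "s permutes {1..n}" by (rule permutes_subset[OF s]) (use assms b in auto)
    moreover have "s a = a" "s b = b" by (rule permutes_not_in[OF s]; use b in simp)+
    ultimately have peel:
        "perm_norm n (s \<circ> transpose a b) = Suc (perm_norm n s)"
        "perm_norm n (transpose c b \<circ> (s \<circ> transpose a b)) = Suc (Suc (perm_norm n s))"
        "perm_norm n (s \<circ> transpose a c \<circ> transpose a b) = Suc (Suc (perm_norm n s))"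
        "perm_norm n (transpose c b \<circ> (s \<circ> transpose a c \<circ> transpose a b)) = Suc (perm_norm n s)"
      by (rule perm_norm_peel[where c = c]; use assms b ac in simp)+
    have refl: "reflection a b = r \<circ> transpose a b"
      using reflection_peel[of a b] b ac by (simp add: r_def)
    \<comment> \<open>The reflection \<open>r\<close> fixes \<open>a\<close> and exchanges
      \<open>Suc a\<close> with \<open>c\<close>, so it conjugates one transposition into the
      other.\<close>
    have r_swap: "transpose a (Suc a) \<circ> r = r \<circ> transpose a c"
      using ac by (auto simp: r_def reflection_def transpose_def fun_eq_iff)
    have s_swap: "inv p \<circ> transpose a (Suc a) \<circ> r = s \<circ> transpose a c"
      by (simp only: s_def comp_assoc r_swap)
    have bij: "bij p" using p by (rule permutes_bij)
    have tpa: "transpose_prod (insert a S) = transpose a (Suc a) \<circ> p"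
      unfolding p_def by (rule transpose_prod_insert_less[OF fin]) (use S in \<open>auto simp: I_def\<close>)
    have tpc: "transpose_prod (insert c S) = p \<circ> transpose c b"
      unfolding p_def b by (rule transpose_prod_insert_greater[OF fin]) (use S in \<open>auto simp: I_def\<close>)
    have tpac: "transpose_prod (insert a (insert c S)) = transpose a (Suc a) \<circ> (p \<circ> transpose c b)"
      unfolding tpc[symmetric]
      by (rule transpose_prod_insert_less) (use S fin ac in \<open>auto simp: I_def\<close>)
    have bij': "bij (p \<circ> transpose c b)" using bij by (simp add: bij_comp)
    have e0: "inv p \<circ> reflection a b = s \<circ> transpose a b"
      by (simp add: refl s_def comp_assoc)
    have e1: "inv (transpose_prod (insert a S)) \<circ> reflection a b =
        s \<circ> transpose a c \<circ> transpose a b"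
      unfolding tpa inv_transpose_comp[OF bij] refl s_swap[symmetric]
      by (simp only: comp_assoc)
    have e2: "inv (transpose_prod (insert c S)) \<circ> reflection a b =
        transpose c b \<circ> (s \<circ> transpose a b)"
      unfolding tpc inv_transpose_comp[OF bij] refl s_def by (simp add: comp_assoc)
    have e3: "inv (transpose_prod (insert a (insert c S))) \<circ> reflection a b =
        transpose c b \<circ> (s \<circ> transpose a c \<circ> transpose a b)"
      unfolding tpac inv_transpose_comp(1)[OF bij'] inv_transpose_comp(2)[OF bij] refl s_swap[symmetric]
      by (simp only: comp_assoc)
    have "card (insert a S) = Suc (card S)" "card (insert c S) = Suc (card S)"
      "card (insert a (insert c S)) = Suc (Suc (card S))"
      using fin notin ac by auto
    then show ?thesis
      unfolding p_def[symmetric] r_def[symmetric] s_def[symmetric] e0 e1 e2 e3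
      by (simp only: peel monomial_def growth_def) (rule ring_eq)
  qed
  then show ?thesis
    unfolding weight_def sum_eq sum_distrib_left using b
    by (intro sum.cong) (simp_all only: diff_Suc_1 I_def)
qed

section \<open>Recursion for the coefficients and the generating function\<close>

lemma rainbow_coeff_eq_weight:
  assumes "1 \<le> n"
  shows "rainbow_coeff n = weight n 1 n"
proof -
  have "rainbow_coeff n = (\<Sum>S\<in>Pow {1..<n}.
      monomial n (inv (transpose_prod S) \<circ> rainbow n) (perm_norm n (transpose_prod S)))"
    unfolding rainbow_coeff_def monomial_def using assms by (rule sum_interval_partitions)
  also have "\<dots> = weight n 1 n"
    unfolding weight_def rainbow_eq_reflection
    by (intro sum.cong) (simp_all add: perm_norm_transpose_prod)
  finally show ?thesis .
qed

text \<open>The two initial values and the factor \<open>growth\<close> depend on neither the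
  ambient size nor the position of the interval, so the two-step recursion determines the weight
  from \<open>k\<close> alone.\<close>

lemma weight_ambient:
  assumes "1 \<le> a" "a + k \<le> n" "1 \<le> a'" "a' + k \<le> n'"
  shows "weight n a (a + k) = weight n' a' (a' + k)"
  using assms
proof (induction k arbitrary: a a' rule: less_induct)
  case (less k)
  consider "k = 0" | "k = 1" | j where "k = j + 2"
  proof -
    have "k = 0 \<or> k = 1 \<or> k = (k - 2) + 2" by arith
    then show thesis using that by blast
  qed
  then show ?case
  proof cases
    case 3
    have "weight n (Suc a) (Suc a + j) = weight n' (Suc a') (Suc a' + j)"
      using less.prems 3 by (intro less.IH) auto
    then show ?thesis using less.prems 3 weight_peel[of a "a + k" n] weight_peel[of a' "a' + k" n']
      by simp
  next
    case 1
    then show ?thesis by (simp only: add_0_right weight_self)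
  next
    case 2
    then show ?thesis using less.prems weight_Suc[of a n] weight_Suc[of a' n']
      by (simp only: Suc_eq_plus1)
  qed
qed

lemma rainbow_coeff_1: "rainbow_coeff 1 = 1"
  by (simp add: rainbow_coeff_eq_weight weight_self)

lemma rainbow_coeff_2: "rainbow_coeff 2 = fps_X + fps_const fps_X"
  using weight_Suc[of 1 2] by (simp add: rainbow_coeff_eq_weight numeral_2_eq_2)

lemma rainbow_coeff_rec:
  assumes "1 \<le> n"
  shows "rainbow_coeff (n + 2) = growth * rainbow_coeff n"
proof -
  \<comment> \<open>The right end \<open>n + 1\<close> is written as \<open>2 + (n - 1)\<close> to
    match \<open>a + k\<close> in \<open>weight_ambient\<close> with
    \<open>k = n - 1\<close>.\<close>
  have "weight (n + 2) 1 (n + 2) = growth * weight (n + 2) 2 (2 + (n - 1))"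
    using weight_peel[of 1 "n + 2" "n + 2"] assms by (simp add: numeral_2_eq_2)
  also have "weight (n + 2) 2 (2 + (n - 1)) = weight n 1 (1 + (n - 1))"
    by (rule weight_ambient) (use assms in auto)
  finally show ?thesis using assms by (simp add: rainbow_coeff_eq_weight)
qed

theorem theorem6p1:
  shows "rainbow_series =
    (var_X + var_X ^ 2 * (var_Y + var_A)) /
    (1 - var_X ^ 2 * var_Y * (1 + 2 * var_Y * var_A + var_A ^ 2))"
proof -
  \<comment> \<open>Seen as a series in \<open>X\<close>, this factor is a constant, so multiplying
    by it acts coefficientwise.\<close>
  have growth: "var_Y * (1 + 2 * var_Y * var_A + var_A ^ 2) = fps_const growth"
    by (simp only: growth_def fps_const_mult[symmetric] fps_const_add[symmetric]
        fps_const_power[symmetric] numeral_fps_const[symmetric] fps_const_1_eq_1)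
  have "rainbow_series * (1 - var_X ^ 2 * fps_const growth) = var_X + var_X ^ 2 * (var_Y + var_A)"
  proof (rule fps_ext)
    fix n :: nat
    have *: "rainbow_series * (1 - var_X ^ 2 * fps_const growth) =
        rainbow_series - var_X ^ 2 * (fps_const growth * rainbow_series)"
      by (simp add: algebra_simps)
    \<comment> \<open>The series has coefficient 0 at index 0, so \<open>n = 2\<close> is an initial
      value; the recursion cancels everything from \<open>n = 3\<close> on.\<close>
    have "n = 0 \<or> n = 1 \<or> n = 2 \<or> (\<exists>m\<ge>1. n = m + 2)"
      by presburger
    then show "fps_nth (rainbow_series * (1 - var_X ^ 2 * fps_const growth)) n =
        fps_nth (var_X + var_X ^ 2 * (var_Y + var_A)) n"
      unfolding *
      by (auto simp: fps_X_power_mult_nth rainbow_series_def rainbow_coeff_1[simplified] rainbow_coeff_2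
          rainbow_coeff_rec simp del: add_2_eq_Suc')
  qed
  \<comment> \<open>This licenses passing from the product identity back to the quotient.\<close>
  moreover have "fps_nth (1 - var_X ^ 2 * fps_const growth) 0 = 1"
    by (simp add: fps_X_power_mult_nth)
  ultimately show ?thesis
    unfolding mult.assoc[of "var_X ^ 2" var_Y] growth by (metis divide_eq_iff_const_1)
qed

end
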